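(* Let $d \ge 2$ and $n > d$ be integers such that $\lfloor d/2 \rfloor$ divides $n$ if $d$ is even, and divides $n-1$ if $d$ is odd, and let $P^*(n,d)$ be the polytope constructed below. If $d$ is even, then for $0 \le k \le d$ \[ f_k(P^*(n,d)) = \sum_{r=\max\{0,\, d/2-k\}}^{d/2-\lfloor k/2\rfloor} \binom{d/2}{r}\binom{d/2-r}{d-k-2r}\left(\frac{n}{d/2}\right)^{d-k-r}. \] If $d$ is odd and $0<k<d$, then \begin{align*} f_k(P^*(n,d)) &= f_{k-1}(P^*(n-1,d-1)) + f_k(P^*(n-1,d-1)) \\ &= \sum_{r=\max\{0,\lfloor d/2\rfloor-(k-1)\}}^{\lfloor d/2\rfloor-\lfloor (k-1)/2\rfloor}\binom{\lfloor d/2\rfloor}{r}\binom{\lfloor d/2\rfloor - r}{d-k-2r}\left(\frac{n-1}{\lfloor d/2\rfloor}\right)^{d-k-r} \\ &\quad + \sum_{r=\max\{0,\lfloor d/2\rfloor-k\}}^{\lfloor d/2\rfloor-\lfloor k/2\rfloor}\binom{\lfloor d/2\rfloor}{r}\binom{\lfloor d/2\rfloor - r}{(d-1)-k-2r}\left(\frac{n-1}{\lfloor d/2\rfloor}\right)^{(d-1)-k-r}. \end{align*}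
   Context: For a polytope $P$, $f_k(P)$ denotes the number of $k$-dimensional faces of $P$. Construction of $P^*(n,d)$: if $d$ is even, for each $1 \le i \le d/2$ let $P_i^* = \{(x_{2i-1},x_{2i}) : A_i (x_{2i-1},x_{2i})^T \le b_i\}$ be a polygon in the $(x_{2i-1},x_{2i})$-plane given by $n/(d/2)$ constraints and having $n/(d/2)$ vertices, and set $P^*(n,d) = \{x\in\mathbb{R}^d : (x_{2i-1},x_{2i}) \in P_i^* \text{ for all } 1\le i\le d/2\}$, defined by the union of all these $n$ constraints. If $d$ is odd, set $P^*(n,d) = \{x \in \mathbb{R}^d : (x_1,\dots,x_{d-1}) \in P^*(n-1,d-1),\ x_d \ge 0\}$ (with $P^*(n-1,d-1)$ as in the even case). Binomial coefficients $\binom{a}{b}$ with $b<0$ or $b>a$ are $0$. *)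

theory Defs
  imports "HOL-Analysis.Analysis"
begin

text \<open>The number of \<open>k\<close>-dimensional faces; it counts the set itself when it is \<open>k\<close>-dimensional,
  and never the empty face, whose \<^const>\<open>aff_dim\<close> is \<open>-1\<close>.\<close>

definition f_num :: "nat \<Rightarrow> 'a::euclidean_space set \<Rightarrow> nat"
  where "f_num k P = card {F. F face_of P \<and> aff_dim F = int k}"

definition constraint_set :: "nat \<Rightarrow> (nat \<Rightarrow> real^2) \<Rightarrow> (nat \<Rightarrow> real) \<Rightarrow> (real^2) set"
  where "constraint_set m A b = {p. \<forall>j\<in>{1..m}. A j \<bullet> p \<le> b j}"

definition polygon_with :: "nat \<Rightarrow> (real^2) set \<Rightarrow> bool"
  where "polygon_with m Q \<longleftrightarrow>
    polytope Q \<and> aff_dim Q = 2 \<and>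
    (\<exists>A b. Q = constraint_set m A b) \<and>
    card {v. v extreme_point_of Q} = m"

text \<open>The admissible choices of the polygons \<open>Q 1, \<dots>, Q (d div 2)\<close> in the construction of
  \<open>P\<^sup>*(n,d)\<close>. For odd \<open>d\<close> they are the polygons of \<open>P\<^sup>*(n-1,d-1)\<close>.\<close>

definition polygon_family :: "nat \<Rightarrow> nat \<Rightarrow> (nat \<Rightarrow> (real^2) set) \<Rightarrow> bool"
  where "polygon_family n d Q \<longleftrightarrow>
    (let m = (if even d then n div (d div 2) else (n - 1) div ((d - 1) div 2))
     in \<forall>i\<in>{1..d div 2}. polygon_with m (Q i))"

definition in_polygons :: "nat \<Rightarrow> (nat \<Rightarrow> (real^2) set) \<Rightarrow> (nat \<Rightarrow> real) \<Rightarrow> bool"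
  where "in_polygons d Q x \<longleftrightarrow>
    (\<forall>i\<in>{1..d div 2}. vector [x (2 * i - 1), x (2 * i)] \<in> Q i)"

text \<open>The polyhedron \<open>P\<^sup>*(n,d)\<close> obtained from the polygons \<open>Q\<close>; the parameter \<open>n\<close> enters only
  through \<open>polygon_family n d Q\<close>. The map \<open>c\<close>, intended to be a bijection from \<open>{1..d}\<close> onto the
  index type, numbers the coordinates: \<open>v $ c j\<close> is the \<open>j\<close>-th coordinate of \<open>v\<close>.\<close>

definition Pstar :: "(nat \<Rightarrow> 'i::finite) \<Rightarrow> nat \<Rightarrow> (nat \<Rightarrow> (real^2) set) \<Rightarrow> (real^'i) set"
  where "Pstar c d Q =
    {v. let x = (\<lambda>j. v $ c j)
        in if even d then in_polygons d Q x
           else in_polygons (d - 1) Q x \<and> 0 \<le> x d}"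

text \<open>Binomial coefficients with integer lower argument, zero below \<open>0\<close> (and above the upper
  argument). With subtraction on \<^typ>\<open>nat\<close> a negative lower argument would become \<open>0\<close> and
  contribute \<open>1\<close>.\<close>

definition binom :: "nat \<Rightarrow> int \<Rightarrow> nat"
  where "binom a b = (if b < 0 then 0 else a choose nat b)"

end

(* Counting the nonempty faces of a polyhedron by dimension gives a generating polynomial that is
   multiplicative on products, since the nonempty faces of S x T are exactly the products of
   nonempty faces. A polygon with m vertices contributes m + m X + X^2, as each vertex lies on
   exactly two edges and each edge has exactly two vertices; the ray [0, oo) contributes 1 + X.
   The face numbers are therefore the coefficients of (m + m X + X^2)^e and
   (1 + X) (m + m X + X^2)^e, where writing m + X (m + X) and expanding twice
   gives the sums over the number r of vertices among the factors. *)

theory Submission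
  imports Defs
begin

section \<open>Dimension of Cartesian products\<close>

text \<open>Containing 0 puts copies of \<open>A\<close> and \<open>B\<close> inside the product,
  which makes its span all of \<open>span A \<times> span B\<close>. Two nonzero singletons show
  that this can fail otherwise.\<close>

lemma dim_Times_zero_mem:
  fixes A :: "'a::euclidean_space set" and B :: "'b::euclidean_space set"
  assumes "0 \<in> A" "0 \<in> B"
  shows "dim (A \<times> B) = dim A + dim B"
proof -
  have "span (A \<times> B) = span A \<times> span B"
  proof (rule antisym)
    show "span (A \<times> B) \<subseteq> span A \<times> span B"
      by (intro span_minimal subspace_Times subspace_span Sigma_mono span_superset)
    have "span A \<times> {0} \<subseteq> span (A \<times> B)"
      unfolding span_Times_sing2[symmetric] using assms by (intro span_mono) auto
    moreover have "{0} \<times> span B \<subseteq> span (A \<times> B)"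
      unfolding span_Times_sing1[symmetric] using assms by (intro span_mono) auto
    ultimately show "span A \<times> span B \<subseteq> span (A \<times> B)"
      using span_add[of "(_, 0)" "A \<times> B" "(0, _)"] by fastforce
  qed
  then show ?thesis
    by (metis dim_Times dim_span subspace_span)
qed

text \<open>Translating a chosen point of each factor to the origin turns affine dimension into
  linear dimension.\<close>

lemma aff_dim_Times:
  fixes S :: "'a::euclidean_space set" and T :: "'b::euclidean_space set"
  assumes "S \<noteq> {}" "T \<noteq> {}"
  shows "aff_dim (S \<times> T) = aff_dim S + aff_dim T"
proof -
  obtain a b where ab: "a \<in> S" "b \<in> T"
    using assms by blast
  have "(+) (- (a, b)) ` (S \<times> T) = (+) (- a) ` S \<times> (+) (- b) ` T"
    by force
  moreover have "0 \<in> (+) (- a) ` S" "0 \<in> (+) (- b) ` T"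
    using ab by force+
  ultimately show ?thesis
    using ab aff_dim_eq_dim[of a S] aff_dim_eq_dim[of b T] aff_dim_eq_dim[of "(a, b)" "S \<times> T"]
    by (simp add: hull_inc dim_Times_zero_mem)
qed

section \<open>Generating polynomial of the face numbers\<close>

text \<open>The empty face is left out because \<open>nat (-1) = 0\<close> would count it among the
  vertices.\<close>

definition face_poly :: "'a::euclidean_space set \<Rightarrow> nat poly"
  where "face_poly S = (\<Sum>F | F face_of S \<and> F \<noteq> {}. monom 1 (nat (aff_dim F)))"

text \<open>Finiteness matters: an infinite sum defaults to 0, whereas a disc, with infinitely many
  faces, still has one face of dimension 2.\<close>

lemma coeff_face_poly:
  assumes "finite {F. F face_of S}"
  shows "coeff (face_poly S) k = f_num k S"
proof -
  have fin: "finite {F. F face_of S \<and> F \<noteq> {}}"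
    using assms by (rule rev_finite_subset) auto
  have "coeff (face_poly S) k = (\<Sum>F | F face_of S \<and> F \<noteq> {}. if nat (aff_dim F) = k then 1 else 0)"
    by (simp add: face_poly_def coeff_sum del: One_nat_def)
  also have "\<dots> = card ({F. F face_of S \<and> F \<noteq> {}} \<inter> {F. nat (aff_dim F) = k})"
    using fin by (simp add: sum.If_cases)
  also have "{F. F face_of S \<and> F \<noteq> {}} \<inter> {F. nat (aff_dim F) = k}
      = {F. F face_of S \<and> aff_dim F = int k}"
  proof (intro set_eqI)
    fix F :: "'a set"
    show "F \<in> {F. F face_of S \<and> F \<noteq> {}} \<inter> {F. nat (aff_dim F) = k}
        \<longleftrightarrow> F \<in> {F. F face_of S \<and> aff_dim F = int k}"
      using aff_dim_negative_iff[of F] by (cases "F = {}") (auto simp del: aff_dim_negative_iff)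
  qed
  finally show ?thesis
    by (simp add: f_num_def)
qed

lemma
  fixes S :: "'a::euclidean_space set" and T :: "'b::euclidean_space set"
  assumes S: "finite {F. F face_of S}" and T: "finite {F. F face_of T}"
  shows finite_faces_Times: "finite {F. F face_of (S \<times> T)}"
    and face_poly_Times: "face_poly (S \<times> T) = face_poly S * face_poly T"
proof -
  have "{F. F face_of (S \<times> T)} = (\<lambda>(F, G). F \<times> G) ` ({F. F face_of S} \<times> {F. F face_of T})"
    by (auto simp: face_of_Times_decomp)
  then show "finite {F. F face_of (S \<times> T)}"
    using assms by simp
  let ?N = "\<lambda>S. {F. F face_of S \<and> F \<noteq> {}}"
  \<comment> \<open>Restricting to nonempty faces makes the map injective, as all products with an
    empty factor coincide.\<close>
  have bij: "bij_betw (\<lambda>(F, G). F \<times> G) (?N S \<times> ?N T) {F. F face_of (S \<times> T) \<and> F \<noteq> {}}"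
    unfolding bij_betw_def inj_on_def
    by (auto simp: face_of_Times_decomp times_eq_iff)
  have mon: "monom 1 (nat (aff_dim F)) * monom 1 (nat (aff_dim G)) = (monom 1 (nat (aff_dim (F \<times> G))) :: nat poly)"
    if "F \<noteq> {}" "G \<noteq> {}" for F :: "'a set" and G :: "'b set"
    using that aff_dim_negative_iff[of F] aff_dim_negative_iff[of G]
    by (simp add: aff_dim_Times mult_monom nat_add_distrib del: One_nat_def aff_dim_negative_iff)
  show "face_poly (S \<times> T) = face_poly S * face_poly T"
    unfolding face_poly_def sum_product sum.cartesian_product
    by (subst sum.reindex_bij_betw[OF bij, symmetric]) (rule sum.cong[OF refl], simp add: mon case_prod_beta mem_Times_iff del: One_nat_def)
qed

text \<open>Serves to count faces in \<open>real^'i\<close> after splitting off coordinates by an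
  embedding into a product space: an injective linear map matches the faces and keeps their
  dimensions.\<close>

lemma
  fixes S :: "'a::euclidean_space set" and f :: "'a \<Rightarrow> 'b::euclidean_space"
  assumes f: "linear f" "inj f"
  shows finite_faces_linear_image: "finite {F. F face_of f ` S} \<longleftrightarrow> finite {F. F face_of S}"
    and face_poly_linear_image: "face_poly (f ` S) = face_poly S"
proof -
  have inj: "inj_on ((`) f) X" for X
    using f(2) by (simp add: inj_on_def inj_image_eq_iff)
  show "finite {F. F face_of f ` S} \<longleftrightarrow> finite {F. F face_of S}"
    unfolding faces_of_linear_image[OF f] by (rule finite_image_iff[OF inj])
  have "{F. F face_of f ` S \<and> F \<noteq> {}} = (`) f ` {F. F face_of S \<and> F \<noteq> {}}"
  proof -
    have "{F. F face_of f ` S \<and> F \<noteq> {}} = {F. F face_of f ` S} - {{}}"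
      by auto
    also have "\<dots> = (`) f ` {F. F face_of S} - {{}}"
      by (simp only: faces_of_linear_image[OF f])
    also have "\<dots> = (`) f ` {F. F face_of S \<and> F \<noteq> {}}"
      by (auto simp del: image_is_empty simp: image_is_empty[of f])
    finally show ?thesis .
  qed
  then show "face_poly (f ` S) = face_poly S"
    using f by (simp add: face_poly_def sum.reindex[OF inj])
qed

section \<open>Face polynomials of a point and of a ray\<close>

lemma face_poly_singleton: "face_poly {a} = 1"
proof -
  have "{F. F face_of {a} \<and> F \<noteq> {}} = {{a}}"
    using face_of_refl[of "{a}"] face_of_imp_subset by blast
  then show ?thesis
    by (simp add: face_poly_def del: One_nat_def)
qed

lemma faces_atLeast: "{F. F face_of {a::real..} \<and> F \<noteq> {}} = {{a}, {a..}}"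
proof -
  \<comment> \<open>For any other point \<open>x\<close> of the ray, \<open>b\<close> lies strictly
    between \<open>x\<close> and a further point of it: \<open>b + 1\<close> if
    \<open>x < b\<close>, and \<open>a\<close> if \<open>x > b\<close>. So a face through
    \<open>b\<close> contains every \<open>x\<close>.\<close>
  have "F = {a..}" if F: "F face_of {a..}" and b: "b \<in> F" "b \<noteq> a" for F b
  proof -
    have ab: "a < b"
      using face_of_imp_subset[OF F] b by force
    have "x \<in> F" if "a \<le> x" for x
    proof (cases "x \<le> b")
      case True
      have "b \<in> open_segment x (b + 1) \<or> x = b"
        using True by (auto simp: open_segment_eq_real_ivl)
      then show ?thesis
        using face_ofD[OF F, of b a "b + 1"] face_ofD[OF F, of b x "b + 1"] ab that b by auto
    next
      case False
      then show ?thesis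
        using face_ofD[OF F, of b a x] ab that b by (auto simp: open_segment_eq_real_ivl)
    qed
    then show ?thesis
      using face_of_imp_subset[OF F] by auto
  qed
  moreover have "{a} face_of {a..}"
    by (auto simp: face_of_singleton extreme_point_of_def open_segment_eq_real_ivl)
  moreover have "{a..} face_of {a..}"
    by (simp add: face_of_refl)
  ultimately show ?thesis
    by blast
qed

lemma face_poly_atLeast: "face_poly {a::real..} = [:1, 1:]"
proof -
  have "aff_dim {a..} = 1"
    using aff_dim_open[of "{a<..}"] aff_dim_subset[of "{a<..}" "{a..}"] aff_dim_le_DIM[of "{a..}"]
    by fastforce
  \<comment> \<open>Distinctness keeps the sum over the two faces from collapsing to one
    term.\<close>
  moreover have "{a} \<noteq> {a..}"
    by (metis atLeast_iff singletonD gt_ex less_imp_le less_irrefl)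
  ultimately show ?thesis
    unfolding face_poly_def faces_atLeast by (simp add: monom_altdef)
qed

section \<open>Vertices and edges of a polygon\<close>

text \<open>A polytope of dimension at most 1 is a simplex, and a 1-simplex is the hull of two
  distinct points.\<close>

lemma polytope_aff_dim_1_segment:
  fixes E :: "'a::euclidean_space set"
  assumes "polytope E" "aff_dim E = 1"
  obtains a b where "a \<noteq> b" "E = closed_segment a b"
proof -
  obtain k where k: "k simplex E"
    using assms polytope_lowdim_imp_simplex by fastforce
  then have "k = 1"
    using aff_dim_simplex assms(2) by blast
  then obtain C where "card C = 2" "E = convex hull C"
    using k unfolding simplex_def by fastforce
  then show thesis
    using that by (metis card_2_iff segment_convex_hull)
qed

lemma card_extreme_points_aff_dim_1:
  fixes E :: "'a::euclidean_space set"
  assumes "polytope E" "aff_dim E = 1"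
  shows "card {v. v extreme_point_of E} = 2"
proof -
  obtain a b where "a \<noteq> b" "E = closed_segment a b"
    using polytope_aff_dim_1_segment assms .
  then show ?thesis
    by (simp add: extreme_point_of_segment Collect_disj_eq Collect_conv_if)
qed

text \<open>Faces of a polyhedron are exposed. Basing the supporting functional at \<open>v\<close>
  in \<open>E\<close> absorbs its bound, which equals \<open>f \<bullet> v\<close>.\<close>

lemma polyhedron_face_functional:
  fixes S :: "'a::euclidean_space set"
  assumes "polyhedron S" "E face_of S" "v \<in> E"
  obtains f where "\<And>x. x \<in> S \<Longrightarrow> f \<bullet> (x - v) \<le> 0" "\<And>x. x \<in> S \<Longrightarrow> x \<in> E \<longleftrightarrow> f \<bullet> (x - v) = 0"
proof -
  obtain f b where "S \<subseteq> {x. f \<bullet> x \<le> b}" "E = S \<inter> {x. f \<bullet> x = b}"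
    using assms exposed_face_of_polyhedron[of S E] unfolding exposed_face_of_def by blast
  then show thesis
    using assms(3) that[of f] by (auto simp: inner_diff_right)
qed

text \<open>A supporting functional of each of three edges at a common vertex would be negative on
  the directions of the other two, so in a linear dependency of the three directions any two
  coefficients would have opposite signs.\<close>

lemma no_three_supported_directions:
  fixes u1 u2 u3 f1 f2 f3 :: "real^2"
  assumes "f1 \<bullet> u1 = 0" "f1 \<bullet> u2 < 0" "f1 \<bullet> u3 < 0"
    and "f2 \<bullet> u1 < 0" "f2 \<bullet> u2 = 0" "f2 \<bullet> u3 < 0"
    and "f3 \<bullet> u1 < 0" "f3 \<bullet> u2 < 0" "f3 \<bullet> u3 = 0"
  shows False
proof -
  \<comment> \<open>The 2 by 2 minors of three plane vectors are the coefficients of a linear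
    dependency between them (Cramer's rule).\<close>
  define a where "a = u2 $ 1 * u3 $ 2 - u2 $ 2 * u3 $ 1"
  define b where "b = u3 $ 1 * u1 $ 2 - u3 $ 2 * u1 $ 1"
  define c where "c = u1 $ 1 * u2 $ 2 - u1 $ 2 * u2 $ 1"
  have "a *\<^sub>R u1 + b *\<^sub>R u2 + c *\<^sub>R u3 = 0"
    by (simp add: vec_eq_iff forall_2 a_def b_def c_def algebra_simps)
  then have "f \<bullet> (a *\<^sub>R u1 + b *\<^sub>R u2 + c *\<^sub>R u3) = 0" for f
    by simp
  then have dep: "a * (f \<bullet> u1) + b * (f \<bullet> u2) + c * (f \<bullet> u3) = 0" for f
    by (simp add: inner_add_right)
  have opp: "sgn p = - sgn q" if "p * x + q * y = 0" "x < 0" "y < 0" for p q x y :: real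
  proof -
    have "p * x = - (q * y)"
      using that(1) by linarith
    then have "sgn (p * x) = sgn (- (q * y))"
      by (rule arg_cong)
    then show ?thesis
      using that by (simp add: sgn_mult sgn_minus)
  qed
  have "sgn b = - sgn c" "sgn a = - sgn c" "sgn a = - sgn b"
    using dep[of f1] dep[of f2] dep[of f3] assms
    by (auto intro: opp[of b "f1 \<bullet> u2" c "f1 \<bullet> u3"] opp[of a "f2 \<bullet> u1" c "f2 \<bullet> u3"]
        opp[of a "f3 \<bullet> u1" b "f3 \<bullet> u2"])
  then have "sgn c = 0"
    by linarith
  then have "c = 0"
    by (simp add: sgn_zero_iff)
  \<comment> \<open>\<open>c = 0\<close> makes \<open>u1\<close> and \<open>u2\<close> parallel. As
    \<open>f1\<close> vanishes on \<open>u1\<close> but not on \<open>u2\<close>, this forces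
    \<open>u1 = 0\<close>, against \<open>f2 \<bullet> u1 < 0\<close>.\<close>
  moreover have "f1 $ 1 * u1 $ 1 + f1 $ 2 * u1 $ 2 = 0" "f1 \<bullet> u2 = f1 $ 1 * u2 $ 1 + f1 $ 2 * u2 $ 2"
    "f2 \<bullet> u1 = f2 $ 1 * u1 $ 1 + f2 $ 2 * u1 $ 2"
    using assms by (simp_all add: inner_vec_def sum_2)
  ultimately have "(f1 \<bullet> u2) * u1 $ 1 = 0" "(f1 \<bullet> u2) * u1 $ 2 = 0"
    unfolding c_def by algebra+
  then show False
    using assms by (auto simp: inner_vec_def sum_2)
qed

text \<open>At least two edges, because \<open>{v}\<close> is the intersection of the facets
  containing it and the facets of a polygon are its edges. At most two, because supporting
  functionals of three edges would contradict \<open>no_three_supported_directions\<close>.\<close>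

lemma card_edges_at_vertex:
  fixes S :: "(real^2) set"
  assumes S: "polytope S" "aff_dim S = 2" and v: "v extreme_point_of S"
  shows "card {E. E face_of S \<and> aff_dim E = 1 \<and> v \<in> E} = 2"
proof -
  define X where "X = {E. E face_of S \<and> aff_dim E = 1 \<and> v \<in> E}"
  have mem: "E face_of S" "aff_dim E = 1" "v \<in> E" if "E \<in> X" for E
    using that by (auto simp: X_def)
  have poly: "polyhedron S"
    using S polytope_imp_polyhedron by blast
  have fin: "finite X"
    using finite_polytope_faces[OF S(1)] by (rule rev_finite_subset) (auto simp: X_def)
  have facets: "{F. F facet_of S \<and> {v} \<subseteq> F} = X"
    using S(2) by (auto simp: facet_of_def X_def)
  have vS: "{v} face_of S" "{v} \<noteq> S"
    using v S(2) by (auto simp: face_of_singleton)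
  have Int: "{v} = \<Inter> X"
    unfolding facets[symmetric] by (rule face_of_polyhedron[OF poly vS(1) _ vS(2)]) simp
  \<comment> \<open>\<open>\<Inter> {}\<close> is \<open>UNIV\<close>, so an empty \<open>X\<close>
    would make the plane a single point.\<close>
  have "X \<noteq> {}"
  proof
    assume "X = {}"
    then have "{v} = UNIV"
      using Int by auto
    then show False
      using aff_dim_sing[of v] aff_dim_UNIV[where 'n = "real^2"] by simp
  qed
  moreover have "X \<noteq> {E}" for E
  proof
    assume X: "X = {E}"
    then have "aff_dim E = 1" "E = {v}"
      using Int mem(2)[of E] by auto
    then show False
      by simp
  qed
  ultimately have ge: "card X \<noteq> 0" "card X \<noteq> 1"
    using fin by (auto simp: card_1_singleton_iff)
  have dir: "\<exists>w \<in> E. w \<noteq> v" if "E \<in> X" for E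
    using aff_dim_eq_0[of E] mem(2,3)[OF that] by fastforce
  \<comment> \<open>The intersection of two distinct edges is a face of each and proper in at least
    one, hence of dimension below 1; a common point besides \<open>v\<close> would raise it to
    1.\<close>
  have ne: "w \<notin> E" if "E \<in> X" "F \<in> X" "E \<noteq> F" "w \<in> F" "w \<noteq> v" for E F w
  proof
    assume w: "w \<in> E"
    have "E \<inter> F face_of E" "E \<inter> F face_of F"
      using mem(1) that face_of_Int[of E S F] by (simp_all add: face_of_face[of E S] face_of_face[of F S])
    then have "E \<inter> F \<noteq> E \<Longrightarrow> aff_dim (E \<inter> F) < 1" "E \<inter> F \<noteq> F \<Longrightarrow> aff_dim (E \<inter> F) < 1"
      using face_of_aff_dim_lt face_of_imp_convex[OF mem(1)] mem(2) that(1,2) by metis+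
    then have "aff_dim (E \<inter> F) < 1"
      using that(3) by metis
    moreover have "aff_dim {v, w} \<le> aff_dim (E \<inter> F)"
      using w mem(3) that by (intro aff_dim_subset) auto
    ultimately show False
      using that by simp
  qed
  have "\<not> 3 \<le> card X"
  proof
    assume "3 \<le> card X"
    then obtain Y where Y: "Y \<subseteq> X" "card Y = 3"
      by (rule obtain_subset_with_card_n) blast
    then obtain E1 E2 E3 where "Y = {E1, E2, E3}" and neq: "E1 \<noteq> E2" "E1 \<noteq> E3" "E2 \<noteq> E3"
      unfolding card_3_iff by blast
    then have E: "E1 \<in> X" "E2 \<in> X" "E3 \<in> X"
      using Y by blast+
    \<comment> \<open>The points \<open>w E\<close> supply directions \<open>w E - v\<close> of the
      edges at \<open>v\<close>. The functional exposing an edge vanishes on its own direction and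
      is negative on those of the other edges.\<close>
    obtain w where w: "\<And>E. E \<in> X \<Longrightarrow> w E \<in> E" "\<And>E. E \<in> X \<Longrightarrow> w E \<noteq> v"
      using dir unfolding Bex_def by metis
    have wS: "w E \<in> S" if "E \<in> X" for E
      using w(1)[OF that] face_of_imp_subset[OF mem(1)[OF that]] by blast
    have "\<forall>F\<in>X. \<exists>f. \<forall>x\<in>S. f \<bullet> (x - v) \<le> 0 \<and> (x \<in> F \<longleftrightarrow> f \<bullet> (x - v) = 0)"
    proof
      fix F assume "F \<in> X"
      note F = mem(1,3)[OF this]
      show "\<exists>f. \<forall>x\<in>S. f \<bullet> (x - v) \<le> 0 \<and> (x \<in> F \<longleftrightarrow> f \<bullet> (x - v) = 0)"
        by (rule polyhedron_face_functional[OF poly F]) blast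
    qed
    then obtain f where
      f: "\<And>F x. F \<in> X \<Longrightarrow> x \<in> S \<Longrightarrow> f F \<bullet> (x - v) \<le> 0 \<and> (x \<in> F \<longleftrightarrow> f F \<bullet> (x - v) = 0)"
      by metis
    have zero: "f F \<bullet> (w F - v) = 0" if "F \<in> X" for F
      using f[OF that wS[OF that]] w(1)[OF that] by blast
    have neg: "f F \<bullet> (w E - v) < 0" if "E \<in> X" "F \<in> X" "F \<noteq> E" for E F
      using f[OF that(2) wS[OF that(1)]] ne[OF that(2,1,3) w(1)[OF that(1)] w(2)[OF that(1)]] by linarith
    show False
      using neq E by (intro no_three_supported_directions[of "f E1" "w E1 - v" "w E2 - v" "w E3 - v" "f E2" "f E3"])
        (rule zero neg; simp)+
  qed
  with ge have "card X = 2"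
    by linarith
  then show ?thesis
    by (simp only: X_def)
qed

text \<open>Double counting: the number of incident pairs is twice the number of vertices and also
  twice the number of edges.\<close>

lemma card_edges_polygon:
  fixes S :: "(real^2) set"
  assumes S: "polytope S" "aff_dim S = 2"
  shows "card {E. E face_of S \<and> aff_dim E = 1} = card {v. v extreme_point_of S}"
proof -
  let ?E = "{E. E face_of S \<and> aff_dim E = 1}" and ?V = "{v. v extreme_point_of S}"
  have fin: "finite ?E" "finite ?V"
    using finite_polytope_faces[OF S(1)] finite_polyhedron_extreme_points S polytope_imp_polyhedron
    by (auto elim: rev_finite_subset)
  have "card {v \<in> ?V. v \<in> E} = 2" if "E \<in> ?E" for E
  proof -
    have "{v \<in> ?V. v \<in> E} = {v. v extreme_point_of E}"
      using that extreme_point_of_face by blast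
    then show ?thesis
      using that face_of_polytope_polytope[OF S(1)] card_extreme_points_aff_dim_1 by auto
  qed
  moreover have "card {E \<in> ?E. v \<in> E} = 2" if "v \<in> ?V" for v
    using card_edges_at_vertex[OF S, of v] that by (simp add: conj_assoc)
  ultimately show ?thesis
    using sum_multicount[of ?V ?E "\<lambda>v E. v \<in> E" 2] sum_multicount_gen[of ?V ?E "\<lambda>v E. v \<in> E" "\<lambda>_. 2"] fin
    by simp
qed

lemma face_poly_polygon:
  assumes "polygon_with m S"
  shows "face_poly S = [:m, m, 1:]"
proof -
  have S: "polytope S" "aff_dim S = 2" "card {v. v extreme_point_of S} = m"
    using assms by (auto simp: polygon_with_def)
  have cvx: "convex S"
    using S polytope_imp_convex by blast
  have fin: "finite {F. F face_of S}"
    using S finite_polytope_faces by blast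
  have "{F. F face_of S \<and> aff_dim F = 0} = (\<lambda>v. {v}) ` {v. v extreme_point_of S}"
    by (auto simp: aff_dim_eq_0 face_of_singleton image_iff)
  then have "f_num 0 S = m"
    using S by (simp add: f_num_def card_image)
  moreover have "f_num 1 S = m"
    using S card_edges_polygon by (simp add: f_num_def)
  \<comment> \<open>A proper face of a convex set has smaller dimension, so only \<open>S\<close>
    itself remains.\<close>
  moreover have "{F. F face_of S \<and> aff_dim F = 2} = {S}"
    using S(2) cvx face_of_refl face_of_aff_dim_lt by fastforce
  then have "f_num 2 S = 1"
    by (simp add: f_num_def)
  moreover have "f_num (Suc (Suc (Suc k))) S = 0" for k
  proof -
    have "{F. F face_of S \<and> aff_dim F = int (Suc (Suc (Suc k)))} = {}"
      using aff_dim_subset[OF face_of_imp_subset, of _ S] S(2) by fastforce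
    then show ?thesis
      by (metis card.empty f_num_def)
  qed
  ultimately have "f_num k S = coeff [:m, m, 1:] k" for k
    by (auto simp: coeff_pCons numeral_2_eq_2 split: nat.split)
  then show ?thesis
    by (simp add: poly_eq_iff coeff_face_poly fin)
qed

section \<open>Products of polygons, without and with a ray\<close>

text \<open>The coordinates not yet constrained are pinned to \<open>0\<close>, so that induction on the number \<open>e\<close> of
  factors can stay in one type \<open>real^'i\<close>.\<close>

definition polygon_product :: "(nat \<Rightarrow> 'i::finite) \<Rightarrow> (nat \<Rightarrow> (real^2) set) \<Rightarrow> nat \<Rightarrow> (real^'i) set"
  where "polygon_product c Q e =
    {v. (\<forall>i\<in>{1..e}. vector [v $ c (2 * i - 1), v $ c (2 * i)] \<in> Q i) \<and> (\<forall>j. j \<notin> c ` {1..2 * e} \<longrightarrow> v $ j = 0)}"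

text \<open>Splitting off the last two coordinates identifies the product of \<open>e + 1\<close>
  polygons with the product of \<open>e\<close> of them times \<open>Q (Suc e)\<close>. Finiteness
  is carried through the induction because \<open>face_poly_Times\<close> requires it.\<close>

lemma face_poly_polygon_product:
  fixes c :: "nat \<Rightarrow> 'i::finite"
  assumes "inj_on c {1..2 * e}" "\<And>i. i \<in> {1..e} \<Longrightarrow> polygon_with m (Q i)"
  shows "finite {F. F face_of polygon_product c Q e} \<and> face_poly (polygon_product c Q e) = [:m, m, 1:] ^ e"
  using assms
proof (induction e)
  case 0
  have "polygon_product c Q 0 = {0}"
    by (auto simp: polygon_product_def vec_eq_iff)
  moreover have "finite {F. F face_of {0 :: real^'i}}"
    using finite_polytope_faces polytope_sing by blast
  ultimately show ?case
    by (simp add: face_poly_singleton)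
next
  case (Suc e)
  have IH: "finite {F. F face_of polygon_product c Q e}" "face_poly (polygon_product c Q e) = [:m, m, 1:] ^ e"
    using Suc.IH Suc.prems inj_on_subset[OF Suc.prems(1), of "{1..2 * e}"] by auto
  have Q: "polygon_with m (Q (Suc e))"
    using Suc.prems by simp
  define a b where "a = c (2 * e + 1)" and "b = c (2 * e + 2)"
  \<comment> \<open>Zeroing the coordinates \<open>a\<close> and \<open>b\<close> makes the first
    component satisfy the pinning condition for \<open>e\<close>; their values move to the second
    component.\<close>
  define g :: "real^'i \<Rightarrow> (real^'i) \<times> (real^2)"
    where "g v = ((\<chi> j. if j = a \<or> j = b then 0 else v $ j), vector [v $ a, v $ b])" for v
  have "a \<noteq> b"
    using inj_onD[OF Suc.prems(1), of "2 * e + 1" "2 * e + 2"] by (auto simp: a_def b_def)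
  have ab: "a \<notin> c ` {1..2 * e}" "b \<notin> c ` {1..2 * e}"
    using inj_on_image_mem_iff[OF Suc.prems(1), of _ "{1..2 * e}"] by (auto simp: a_def b_def)
  have lin: "linear g"
    by (rule linearI) (simp_all add: g_def vec_eq_iff forall_2)
  have inj: "inj g"
  proof (rule injI)
    fix v w assume "g v = g w"
    then show "v = w"
      by (simp add: g_def vec_eq_iff forall_2) metis
  qed
  have img: "c ` {1..2 * Suc e} = insert a (insert b (c ` {1..2 * e}))"
    by (auto simp: a_def b_def atLeastAtMostSuc_conv)
  have mem: "v \<in> polygon_product c Q (Suc e) \<longleftrightarrow> g v \<in> polygon_product c Q e \<times> Q (Suc e)" for v
  proof -
    have "c (2 * i - 1) \<noteq> a \<and> c (2 * i - 1) \<noteq> b \<and> c (2 * i) \<noteq> a \<and> c (2 * i) \<noteq> b" if "i \<in> {1..e}" for i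
    proof -
      have "c (2 * i - 1) \<in> c ` {1..2 * e}" "c (2 * i) \<in> c ` {1..2 * e}"
        using that by (auto intro!: imageI)
      then show ?thesis
        using ab by metis
    qed
    then have "(\<forall>i\<in>{1..Suc e}. vector [v $ c (2 * i - 1), v $ c (2 * i)] \<in> Q i)
      \<longleftrightarrow> (\<forall>i\<in>{1..e}. vector [fst (g v) $ c (2 * i - 1), fst (g v) $ c (2 * i)] \<in> Q i) \<and> snd (g v) \<in> Q (Suc e)"
      by (auto simp: atLeastAtMostSuc_conv g_def a_def b_def)
    moreover have "(\<forall>j. j \<notin> c ` {1..2 * Suc e} \<longrightarrow> v $ j = 0)
      \<longleftrightarrow> (\<forall>j. j \<notin> c ` {1..2 * e} \<longrightarrow> fst (g v) $ j = 0)"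
      unfolding img using ab by (auto simp: g_def)
    ultimately show ?thesis
      by (auto simp: polygon_product_def mem_Times_iff)
  qed
  \<comment> \<open>\<open>g\<close> is not onto: first components of its values vanish at
    \<open>a\<close> and \<open>b\<close>. The pinning provides this for \<open>p\<close>.\<close>
  have range: "(p, q) \<in> range g" if "p \<in> polygon_product c Q e" for p q
  proof
    show "(p, q) = g (\<chi> j. if j = a then q $ 1 else if j = b then q $ 2 else p $ j)"
      using that ab \<open>a \<noteq> b\<close> by (auto simp: g_def vec_eq_iff forall_2 polygon_product_def)
  qed simp
  have "polygon_product c Q (Suc e) = g -` (polygon_product c Q e \<times> Q (Suc e))"
    by (rule set_eqI) (simp only: vimage_eq mem)
  then have im: "g ` polygon_product c Q (Suc e) = polygon_product c Q e \<times> Q (Suc e)"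
    using range by (simp only: image_vimage_eq) blast
  have fin: "finite {F. F face_of Q (Suc e)}"
    using Q finite_polytope_faces by (auto simp: polygon_with_def)
  have "face_poly (polygon_product c Q (Suc e)) = face_poly (g ` polygon_product c Q (Suc e))"
    by (simp only: face_poly_linear_image[OF lin inj])
  also have "\<dots> = [:m, m, 1:] ^ e * [:m, m, 1:]"
    by (simp only: im face_poly_Times[OF IH(1) fin] IH(2) face_poly_polygon[OF Q])
  finally have "face_poly (polygon_product c Q (Suc e)) = [:m, m, 1:] ^ e * [:m, m, 1:]" .
  moreover have "finite {F. F face_of g ` polygon_product c Q (Suc e)}"
    unfolding im by (rule finite_faces_Times[OF IH(1) fin])
  then have "finite {F. F face_of polygon_product c Q (Suc e)}"
    by (simp only: finite_faces_linear_image[OF lin inj])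
  ultimately show ?case
    by (simp only: power_Suc2 simp_thms)
qed

text \<open>Here a single coordinate \<open>a\<close> is split off, the one ranging over the ray. As
  \<open>c\<close> is onto, \<open>a\<close> is also the only coordinate pinned in the first
  component.\<close>

lemma face_poly_polygon_product_ray:
  fixes c :: "nat \<Rightarrow> 'i::finite"
  assumes "bij_betw c {1..Suc (2 * e)} UNIV" "\<And>i. i \<in> {1..e} \<Longrightarrow> polygon_with m (Q i)"
  defines "P \<equiv> {v. (\<forall>i\<in>{1..e}. vector [v $ c (2 * i - 1), v $ c (2 * i)] \<in> Q i) \<and> 0 \<le> v $ c (Suc (2 * e))}"
  shows "finite {F. F face_of P} \<and> face_poly P = [:1, 1:] * [:m, m, 1:] ^ e"
proof -
  have inj_c: "inj_on c {1..Suc (2 * e)}"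
    using assms by (simp add: bij_betw_def)
  then have "inj_on c {1..2 * e}"
    by (rule inj_on_subset) auto
  note prod = face_poly_polygon_product[OF this assms(2)]
  define a where "a = c (Suc (2 * e))"
  define g :: "real^'i \<Rightarrow> (real^'i) \<times> real" where "g v = ((\<chi> j. if j = a then 0 else v $ j), v $ a)" for v
  have a: "a \<notin> c ` {1..2 * e}"
    using inj_on_image_mem_iff[OF inj_c, of _ "{1..2 * e}"] by (auto simp: a_def)
  have "UNIV = insert a (c ` {1..2 * e})"
    using assms(1) by (auto simp: bij_betw_def a_def atLeastAtMostSuc_conv)
  then have outside: "j \<notin> c ` {1..2 * e} \<longleftrightarrow> j = a" for j
    using a by auto
  have lin: "linear g"
    by (rule linearI) (simp_all add: g_def vec_eq_iff)
  have inj: "inj g"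
  proof (rule injI)
    fix v w assume "g v = g w"
    then show "v = w"
      by (simp add: g_def vec_eq_iff) metis
  qed
  have mem: "v \<in> P \<longleftrightarrow> g v \<in> polygon_product c Q e \<times> {0..}" for v
  proof -
    have "c (2 * i - 1) \<noteq> a \<and> c (2 * i) \<noteq> a" if "i \<in> {1..e}" for i
    proof -
      have "c (2 * i - 1) \<in> c ` {1..2 * e}" "c (2 * i) \<in> c ` {1..2 * e}"
        using that by (auto intro!: imageI)
      then show ?thesis
        using a by metis
    qed
    then show ?thesis
      by (auto simp: P_def polygon_product_def g_def outside simp flip: a_def simp del: One_nat_def)
  qed
  have range: "(p, q) \<in> range g" if "p \<in> polygon_product c Q e" for p q
  proof
    show "(p, q) = g (\<chi> j. if j = a then q else p $ j)"
      using that a by (auto simp: g_def vec_eq_iff polygon_product_def)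
  qed simp
  have "P = g -` (polygon_product c Q e \<times> {0..})"
    by (rule set_eqI) (simp only: vimage_eq mem)
  then have im: "g ` P = polygon_product c Q e \<times> {0..}"
    using range by (simp only: image_vimage_eq) blast
  have fin: "finite {F. F face_of {0::real..}}"
  proof -
    have "{F. F face_of {0::real..}} \<subseteq> insert {} {F. F face_of {0..} \<and> F \<noteq> {}}"
      by auto
    then show ?thesis
      unfolding faces_atLeast by (rule finite_subset) simp
  qed
  have "face_poly P = face_poly (g ` P)"
    by (simp only: face_poly_linear_image[OF lin inj])
  also have "\<dots> = [:m, m, 1:] ^ e * [:1, 1:]"
    by (simp only: im face_poly_Times[OF prod[THEN conjunct1] fin] prod[THEN conjunct2] face_poly_atLeast)
  finally have "face_poly P = [:m, m, 1:] ^ e * [:1, 1:]" .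
  moreover have "finite {F. F face_of g ` P}"
    unfolding im by (rule finite_faces_Times[OF prod[THEN conjunct1] fin])
  then have "finite {F. F face_of P}"
    by (simp only: finite_faces_linear_image[OF lin inj])
  ultimately show ?thesis
    by (simp only: mult.commute simp_thms)
qed

section \<open>Coefficients of the trinomial power\<close>

text \<open>Among the \<open>e\<close> factors \<open>m + X (m + X)\<close>, \<open>r\<close> of
  them contribute \<open>m\<close>; the others leave \<open>X^(e-r) (m+X)^(e-r)\<close>, whose
  coefficient at \<open>k\<close> is a second binomial. Symmetry of binomials turns its lower
  argument \<open>k - (e - r)\<close> into \<open>2 e - k - 2 r\<close>.\<close>

lemma coeff_trinomial_power:
  fixes m e k :: nat
  assumes "k \<le> 2 * e"
  shows "coeff ([:m, m, 1:] ^ e) k = (\<Sum>r = max 0 (e - k)..e - k div 2.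
            (e choose r) * binom (e - r) (int (2 * e) - int k - 2 * int r) * m ^ (2 * e - k - r))"
proof -
  let ?t = "\<lambda>r. (e choose r) * binom (e - r) (int (2 * e) - int k - 2 * int r) * m ^ (2 * e - k - r)"
  have "[:m, m, 1:] = [:m:] + monom 1 1 * [:m, 1:]"
    by (simp add: monom_altdef)
  then have expand: "[:m, m, 1:] ^ e = (\<Sum>r\<le>e. of_nat (e choose r) * [:m:] ^ r * (monom 1 1 * [:m, 1:]) ^ (e - r))"
    by (simp only: binomial_ring)
  have "coeff ([:m, m, 1:] ^ e) k = (\<Sum>r\<le>e. (e choose r) * m ^ r * coeff (monom 1 (e - r) * [:m, 1:] ^ (e - r)) k)"
    unfolding expand coeff_sum
  proof (rule sum.cong[OF refl])
    fix r
    have "of_nat (e choose r) * [:m:] ^ r * (monom 1 1 * q) ^ (e - r)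
      = smult ((e choose r) * m ^ r) (monom 1 (e - r) * q ^ (e - r))" for q
      by (simp add: of_nat_poly poly_const_pow power_mult_distrib monom_power mult.commute del: One_nat_def)
    from this[of "[:m, 1:]"] show "coeff (of_nat (e choose r) * [:m:] ^ r * (monom 1 1 * [:m, 1:]) ^ (e - r)) k
        = (e choose r) * m ^ r * coeff (monom 1 (e - r) * [:m, 1:] ^ (e - r)) k"
      by simp
  qed
  also have "\<dots> = (\<Sum>r\<le>e. ?t r)"
  proof (rule sum.cong[OF refl])
    fix r assume "r \<in> {..e}"
    then have r: "r \<le> e"
      by simp
    \<comment> \<open>Stated for all \<open>i\<close>, because the case of large \<open>k\<close>
      below asks for coefficients beyond the degree.\<close>
    have co: "coeff ([:m, 1:] ^ n) i = (n choose i) * m ^ (n - i)" for n i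
    proof (cases "i \<le> n")
      case True
      then show ?thesis
        by (simp add: coeff_linear_poly_power del: One_nat_def)
    next
      case False
      have "degree ([:m, 1:] ^ n) \<le> n"
        using degree_power_le[of "[:m, 1:]" n] by simp
      then show ?thesis
        using False by (simp add: coeff_eq_0 binomial_eq_0)
    qed
    \<comment> \<open>The polynomial has exponents only from \<open>e - r\<close> to
      \<open>2 * (e - r)\<close>. For smaller \<open>k\<close> the lower argument of
      \<open>binom\<close> exceeds \<open>e - r\<close>; for larger \<open>k\<close> it is
      negative.\<close>
    consider "k < e - r" | "e - r \<le> k" "k \<le> 2 * (e - r)" | "2 * (e - r) < k"
      by linarith
    then show "(e choose r) * m ^ r * coeff (monom 1 (e - r) * [:m, 1:] ^ (e - r)) k = ?t r"
    proof cases
      case 1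
      then have "nat (int (2 * e) - int k - 2 * int r) > e - r"
        using r by linarith
      then show ?thesis
        using 1 by (simp add: coeff_monom_mult binom_def binomial_eq_0 del: One_nat_def)
    next
      case 2
      have n: "nat (int (2 * e) - int k - 2 * int r) = (e - r) - (k - (e - r))"
        "\<not> int (2 * e) - int k - 2 * int r < 0"
        using 2 r by linarith+
      have "r + ((e - r) - (k - (e - r))) = 2 * e - k - r" and le: "k - (e - r) \<le> e - r"
        using 2 r by linarith+
      then have pow: "m ^ (2 * e - k - r) = m ^ r * m ^ ((e - r) - (k - (e - r)))"
        by (simp only: power_add[symmetric])
      have "coeff (monom 1 (e - r) * [:m, 1:] ^ (e - r)) k
          = ((e - r) choose ((e - r) - (k - (e - r)))) * m ^ ((e - r) - (k - (e - r)))"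
        using 2 unfolding binomial_symmetric[OF le, symmetric]
        by (simp add: coeff_monom_mult co del: One_nat_def)
      moreover have "binom (e - r) (int (2 * e) - int k - 2 * int r) = (e - r) choose ((e - r) - (k - (e - r)))"
        by (simp only: binom_def n if_False)
      ultimately show ?thesis
        unfolding pow by (simp only: ac_simps)
    next
      case 3
      then have "int (2 * e) - int k - 2 * int r < 0" "k - (e - r) > e - r"
        using r by linarith+
      then show ?thesis
        by (simp add: coeff_monom_mult binom_def co binomial_eq_0 del: One_nat_def)
    qed
  qed
  \<comment> \<open>For odd \<open>k\<close> the upper limit lies one beyond the last nonzero
    binomial: the lower argument there is \<open>-1\<close>, and \<open>binom\<close> makes the term
    0.\<close>
  also have "\<dots> = (\<Sum>r = max 0 (e - k)..e - k div 2. ?t r)"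
  proof (rule sum.mono_neutral_right)
    show "\<forall>r\<in>{..e} - {max 0 (e - k)..e - k div 2}. ?t r = 0"
    proof
      fix r assume "r \<in> {..e} - {max 0 (e - k)..e - k div 2}"
      then have "r \<le> e" "r < e - k \<or> r > e - k div 2"
        by auto
      then have "int (2 * e) - int k - 2 * int r < 0 \<or> nat (int (2 * e) - int k - 2 * int r) > e - r"
        using assms by linarith
      then show "?t r = 0"
        by (auto simp: binom_def binomial_eq_0)
    qed
  qed auto
  finally show ?thesis .
qed

section \<open>Face numbers of the construction\<close>

text \<open>As \<open>c\<close> is onto, no coordinate is pinned, so \<open>Pstar\<close> is
  \<open>polygon_product\<close> itself.\<close>

lemma f_num_Pstar_even:
  fixes c :: "nat \<Rightarrow> 'i::finite"
  assumes "bij_betw c {1..2 * e} UNIV" "\<And>i. i \<in> {1..e} \<Longrightarrow> polygon_with m (Q i)"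
  shows "f_num k (Pstar c (2 * e) Q) = coeff ([:m, m, 1:] ^ e) k"
proof -
  have "inj_on c {1..2 * e}" "c ` {1..2 * e} = UNIV"
    using assms(1) by (simp_all add: bij_betw_def)
  moreover from this(2) have "Pstar c (2 * e) Q = polygon_product c Q e"
    by (simp add: Pstar_def in_polygons_def polygon_product_def Let_def)
  moreover note face_poly_polygon_product[OF \<open>inj_on c {1..2 * e}\<close> assms(2)]
  ultimately show ?thesis
    by (simp flip: coeff_face_poly)
qed

text \<open>Each nonempty face of the base gives one face of the same dimension, at the origin of
  the ray, and one of the next dimension, along the whole ray; so the factor \<open>1 + X\<close>
  adds neighbouring coefficients.\<close>

lemma f_num_Pstar_odd:
  fixes c :: "nat \<Rightarrow> 'i::finite"
  assumes "bij_betw c {1..Suc (2 * e)} UNIV" "\<And>i. i \<in> {1..e} \<Longrightarrow> polygon_with m (Q i)"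
  shows "f_num (Suc k) (Pstar c (Suc (2 * e)) Q)
    = coeff ([:m, m, 1:] ^ e) k + coeff ([:m, m, 1:] ^ e) (Suc k)"
proof -
  have "Pstar c (Suc (2 * e)) Q
      = {v. (\<forall>i\<in>{1..e}. vector [v $ c (2 * i - 1), v $ c (2 * i)] \<in> Q i) \<and> 0 \<le> v $ c (Suc (2 * e))}"
    by (simp add: Pstar_def in_polygons_def Let_def)
  then show ?thesis
    using face_poly_polygon_product_ray[OF assms] by (simp add: add.commute flip: coeff_face_poly)
qed

text \<open>The odd case compares polyhedra in spaces of dimensions \<open>d\<close> and
  \<open>d - 1\<close>, hence the second index type \<open>'j\<close> with its own numbering
  \<open>c'\<close>.\<close>

theorem theorem3p3:
  fixes n d :: nat
    and Q :: "nat \<Rightarrow> (real^2) set"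
    and c :: "nat \<Rightarrow> 'i::finite"
    and c' :: "nat \<Rightarrow> 'j::finite"
  assumes "d \<ge> 2" and "n > d"
    and "even d \<Longrightarrow> d div 2 dvd n"
    and "odd d \<Longrightarrow> d div 2 dvd n - 1"
    and "polygon_family n d Q"
    and "bij_betw c {1..d} (UNIV :: 'i set)"
  shows "(even d \<longrightarrow>
      (\<forall>k\<in>{0..d}.
        f_num k (Pstar c d Q) =
          (\<Sum>r = max 0 (d div 2 - k)..d div 2 - k div 2.
            (d div 2 choose r) * binom (d div 2 - r) (int d - int k - 2 * int r)
              * (n div (d div 2)) ^ (d - k - r))))
    \<and> (odd d \<and> bij_betw c' {1..d - 1} (UNIV :: 'j set) \<longrightarrow>
      (\<forall>k. 0 < k \<and> k < d \<longrightarrow>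
        f_num k (Pstar c d Q) =
          f_num (k - 1) (Pstar c' (d - 1) Q) + f_num k (Pstar c' (d - 1) Q)
        \<and> f_num (k - 1) (Pstar c' (d - 1) Q) + f_num k (Pstar c' (d - 1) Q) =
          (\<Sum>r = max 0 (d div 2 - (k - 1))..d div 2 - (k - 1) div 2.
            (d div 2 choose r) * binom (d div 2 - r) (int d - int k - 2 * int r)
              * ((n - 1) div (d div 2)) ^ (d - k - r))
          + (\<Sum>r = max 0 (d div 2 - k)..d div 2 - k div 2.
            (d div 2 choose r) * binom (d div 2 - r) ((int d - 1) - int k - 2 * int r)
              * ((n - 1) div (d div 2)) ^ ((d - 1) - k - r))))"
proof (intro conjI impI ballI allI)
  define e where "e = d div 2"
  define m where "m = (if even d then n div e else (n - 1) div e)"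
  have "(d - 1) div 2 = e" if "odd d"
    using that by (auto simp: e_def elim: oddE)
  then have poly: "polygon_with m (Q i)" if "i \<in> {1..e}" for i
    using assms(5) that by (auto simp: polygon_family_def Let_def m_def simp flip: e_def split: if_splits)
  {
    fix k assume "even d" "k \<in> {0..d}"
    then have d: "d = 2 * e" and k: "k \<le> 2 * e" and m: "n div e = m"
      by (auto simp: e_def m_def)
    have "bij_betw c {1..2 * e} UNIV"
      using assms(6) d by simp
    then have "f_num k (Pstar c (2 * e) Q) = coeff ([:m, m, 1:] ^ e) k"
      using poly by (rule f_num_Pstar_even)
    then show "f_num k (Pstar c d Q) =
          (\<Sum>r = max 0 (d div 2 - k)..d div 2 - k div 2.
            (d div 2 choose r) * binom (d div 2 - r) (int d - int k - 2 * int r)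
              * (n div (d div 2)) ^ (d - k - r))"
      unfolding e_def[symmetric] m coeff_trinomial_power[OF k] by (simp only: d)
  }
  {
    fix k assume "odd d \<and> bij_betw c' {1..d - 1} (UNIV :: 'j set)" and "0 < k \<and> k < d"
    then have d: "d = Suc (2 * e)" and m: "(n - 1) div e = m"
      and c': "bij_betw c' {1..2 * e} (UNIV :: 'j set)"
      by (auto simp: e_def m_def)
    obtain l where l: "k = Suc l"
      using \<open>0 < k \<and> k < d\<close> gr0_implies_Suc by blast
    have le: "l \<le> 2 * e" "Suc l \<le> 2 * e"
      using \<open>0 < k \<and> k < d\<close> d l by auto
    have c: "bij_betw c {1..Suc (2 * e)} UNIV"
      using assms(6) d by simp
    have d1: "d - 1 = 2 * e" "k - 1 = l"
      using d l by simp_all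
    have even: "f_num i (Pstar c' (2 * e) Q) = coeff ([:m, m, 1:] ^ e) i" for i
      using c' poly by (rule f_num_Pstar_even)
    have odd: "f_num (Suc l) (Pstar c (Suc (2 * e)) Q)
        = coeff ([:m, m, 1:] ^ e) l + coeff ([:m, m, 1:] ^ e) (Suc l)"
      using c poly by (rule f_num_Pstar_odd)
    show "f_num k (Pstar c d Q) = f_num (k - 1) (Pstar c' (d - 1) Q) + f_num k (Pstar c' (d - 1) Q)"
      unfolding d1 even unfolding d l by (rule odd)
    \<comment> \<open>With \<open>k = Suc l\<close> one has \<open>d - k = 2 * e - l\<close>, so the
      first sum is the coefficient at \<open>k - 1\<close> and the second the one at
      \<open>k\<close>.\<close>
    have ex: "int d - int k - 2 * int r = int (2 * e) - int l - 2 * int r"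
      "int d - 1 - int k - 2 * int r = int (2 * e) - int (Suc l) - 2 * int r"
      "d - k - r = 2 * e - l - r" for r
      using d l by auto
    show "f_num (k - 1) (Pstar c' (d - 1) Q) + f_num k (Pstar c' (d - 1) Q) =
          (\<Sum>r = max 0 (d div 2 - (k - 1))..d div 2 - (k - 1) div 2.
            (d div 2 choose r) * binom (d div 2 - r) (int d - int k - 2 * int r)
              * ((n - 1) div (d div 2)) ^ (d - k - r))
          + (\<Sum>r = max 0 (d div 2 - k)..d div 2 - k div 2.
            (d div 2 choose r) * binom (d div 2 - r) ((int d - 1) - int k - 2 * int r)
              * ((n - 1) div (d div 2)) ^ ((d - 1) - k - r))"
      unfolding ex d1 e_def[symmetric] m even
      unfolding l coeff_trinomial_power[OF le(1)] coeff_trinomial_power[OF le(2)]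
      by (rule refl)
  }
qed

end
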